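(* For every positive integer $n$, we have $$\frac{2^{n-1}}{n}\leq \mu_t(Q_n)\leq \frac{2^n}{n}.$$ If $n=2^m-1$ for some positive integer $m$, then $$\frac{2^n}{n+1}\leq \mu_t(Q_n)\leq \frac{2^n}{n}.$$
   Context: For a positive integer $n$, write $[n]=\{1,\dots,n\}$. The $n$-dimensional hypercube $Q_n$ is the graph on the vertex set $2^{[n]}$ (all subsets of $[n]$), where $A,B\in 2^{[n]}$ are adjacent if and only if $|A\Delta B|=1$, with $A\Delta B=(A\setminus B)\cup(B\setminus A)$. Let $G$ be a simple graph and $M\subseteq V(G)$. Two vertices $u,v\in V(G)$ are $M$-visible if there exists a shortest $u,v$-path in $G$ that contains no vertices from $M\setminus\{u,v\}$. The set $M$ is a total mutual-visibility set if any two vertices $u,v\in V(G)$ are $M$-visible. The total mutual-visibility number $\mu_t(G)$ is the largest size of a total mutual-visibility set in $G$. *)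

theory Defs
  imports Complex_Main "Graph_Theory.Pair_Digraph" "Graph_Theory.Vertex_Walk"
begin

text \<open>
  Simple graphs are represented as the loop-free symmetric digraphs without parallel arcs
  of locale \<^locale>\<open>pair_graph\<close>: an edge \<open>uv\<close> is the pair of arcs \<open>(u, v)\<close> and \<open>(v, u)\<close>,
  and paths are given by their lists of vertices.
\<close>

definition is_shortest_path ::
  "'a pair_pre_digraph \<Rightarrow> 'a \<Rightarrow> 'a vwalk \<Rightarrow> 'a \<Rightarrow> bool" where
  "is_shortest_path G u p v \<longleftrightarrow>
     vpath p G \<and> hd p = u \<and> last p = v \<and>
     (\<forall>q. vpath q G \<and> hd q = u \<and> last q = v \<longrightarrow> vwalk_length p \<le> vwalk_length q)"

definition visible :: "'a pair_pre_digraph \<Rightarrow> 'a set \<Rightarrow> 'a \<Rightarrow> 'a \<Rightarrow> bool" where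
  "visible G M u v \<longleftrightarrow> (\<exists>p. is_shortest_path G u p v \<and> set p \<inter> (M - {u, v}) = {})"

definition total_mutual_visibility_set :: "'a pair_pre_digraph \<Rightarrow> 'a set \<Rightarrow> bool" where
  "total_mutual_visibility_set G M \<longleftrightarrow>
     M \<subseteq> pverts G \<and> (\<forall>u\<in>pverts G. \<forall>v\<in>pverts G. visible G M u v)"

text \<open>
  The maximum is meaningful for finite connected graphs only: in a disconnected graph
  no set, not even the empty one, is a total mutual-visibility set.
\<close>

definition total_mutual_visibility_number :: "'a pair_pre_digraph \<Rightarrow> nat" ("\<mu>\<^sub>t") where
  "\<mu>\<^sub>t G = Max (card ` {M. total_mutual_visibility_set G M})"

definition hypercube :: "nat \<Rightarrow> nat set pair_pre_digraph" where
  "hypercube n =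
     \<lparr> pverts = Pow {1..n},
       parcs = {(A, B) \<in> Pow {1..n} \<times> Pow {1..n}. card ((A - B) \<union> (B - A)) = 1} \<rparr>"

lemma pair_graph_hypercube: "pair_graph (hypercube n)"
proof -
  have "finite (parcs (hypercube n))"
    by (rule finite_subset[of _ "Pow {1..n} \<times> Pow {1..n}"]) (auto simp: hypercube_def)
  moreover have "sym (parcs (hypercube n))"
    by (auto simp: sym_def hypercube_def Un_commute)
  ultimately show ?thesis
    by unfold_locales (auto simp: hypercube_def symmetric_def)
qed

end

theory Submission
  imports Defs
begin

text \<open>
  In the hypercube, two vertices at distance 2 have exactly two common neighbours, which are
  again at distance 2 from each other. Hence a total mutual-visibility set is the same thing as
  a set of vertices no two of which are at distance exactly 2: conversely, from \<open>u\<close> there are at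
  least two first steps towards a vertex \<open>v\<close> at distance at least 2, and at most one of them is
  blocked. The upper bound holds because the neighbourhoods of the members of such a set are
  disjoint. For the lower bound, label the coordinates by distinct binary words of length \<open>k\<close>,
  where \<open>n < 2 ^ k \<le> 2 * n\<close>, and split the cube by the bitwise sum mod 2 of the labels (the
  Hamming syndrome): each of the \<open>2 ^ k\<close> classes contains no two vertices at distance 2. If
  \<open>n = 2 ^ m - 1\<close>, then \<open>k = m\<close> gives the sharper bound.
\<close>

section \<open>Walks in the hypercube and Hamming distance\<close>

lemma vwalk_hypercube_Cons:
  assumes "vwalk p (hypercube n)" "A \<subseteq> {1..n}" "card (sym_diff A (hd p)) = 1"
  shows "vwalk (A # p) (hypercube n)"
proof -
  have "hd p \<in> Pow {1..n}"
    using assms(1) by (cases p) (auto simp: vwalk_def hypercube_def)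
  then show ?thesis
    using assms by (intro vwalk_consI) (auto simp: hypercube_def)
qed

text \<open>Each arc flips a single coordinate, and \<open>card (sym_diff _ _)\<close> obeys the
  triangle inequality.\<close>

lemma hypercube_vwalk_length_ge:
  assumes "vwalk p (hypercube n)"
  shows "card (sym_diff (hd p) (last p)) \<le> vwalk_length p"
proof -
  have "last p \<subseteq> {1..n} \<and> card (sym_diff (hd p) (last p)) \<le> vwalk_length p"
    using assms
  proof (induction p rule: vwalk_induct)
    case (Cons A B p)
    let ?C = "last (B # p)"
    have "A \<subseteq> {1..n}" "B \<subseteq> {1..n}" and 1: "card (sym_diff A B) = 1"
      using Cons.hyps by (auto simp: hypercube_def)
    moreover have "?C \<subseteq> {1..n}"
      using Cons.IH ..
    ultimately have "finite A" "finite B" "finite ?C"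
      by (meson finite_atLeastAtMost finite_subset)+
    then have "finite (sym_diff A B \<union> sym_diff B ?C)"
      by (intro finite_UnI finite_Diff)
    then have "card (sym_diff A ?C) \<le> card (sym_diff A B \<union> sym_diff B ?C)"
      by (rule card_mono) blast
    also have "\<dots> \<le> card (sym_diff A B) + card (sym_diff B ?C)"
      by (rule card_Un_le)
    also have "\<dots> \<le> vwalk_length (A # B # p)"
      using Cons.IH 1 by simp
    finally show ?case
      using Cons.IH by simp
  qed (simp add: hypercube_def)
  then show ?thesis ..
qed

text \<open>The walk is built greedily, flipping a coordinate of \<open>sym_diff A B\<close> at each
  step and choosing it so that the next vertex avoids \<open>M\<close>. With \<open>M = {}\<close>
  this merely says that the Hamming distance is attained.\<close>

lemma hypercube_visible_path:
  assumes "A \<subseteq> {1..n}" "B \<subseteq> {1..n}"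
    and M: "\<forall>A\<in>M. \<forall>B\<in>M. card (sym_diff A B) \<noteq> 2"
  shows "\<exists>p. vwalk p (hypercube n) \<and> hd p = A \<and> last p = B \<and>
    vwalk_length p = card (sym_diff A B) \<and> set p \<inter> (M - {A, B}) = {}"
  using assms(1)
proof (induction "card (sym_diff A B)" arbitrary: A)
  case 0
  have "finite (sym_diff A B)"
    using 0(2) assms(2) by (meson finite_Diff finite_Un finite_atLeastAtMost finite_subset)
  with 0 have "A = B" by auto
  then show ?case
    using 0(2) by (intro exI[of _ "[A]"]) (auto simp: vwalk_def hypercube_def)
next
  case (Suc d)
  have fin: "finite (sym_diff A B)"
    using Suc.prems assms(2) by (meson finite_Diff finite_Un finite_atLeastAtMost finite_subset)
  have step: "sym_diff A {i} \<subseteq> {1..n}" "card (sym_diff A (sym_diff A {i})) = 1"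
    "card (sym_diff (sym_diff A {i}) B) = d" if "i \<in> sym_diff A B" for i
  proof -
    show "sym_diff A {i} \<subseteq> {1..n}"
      using that Suc.prems assms(2) by auto
    have "sym_diff A (sym_diff A {i}) = {i}" by blast
    then show "card (sym_diff A (sym_diff A {i})) = 1" by simp
    have "sym_diff (sym_diff A {i}) B = sym_diff A B - {i}"
      using that by blast
    then show "card (sym_diff (sym_diff A {i}) B) = d"
      using that fin Suc.hyps(2) by simp
  qed
  \<comment> \<open>If \<open>d = 0\<close>, the next vertex is \<open>B\<close> itself, which may
    lie in \<open>M\<close>. Otherwise two candidates for the next vertex are at distance 2, so
    \<open>M\<close> misses one of them.\<close>
  obtain i where i: "i \<in> sym_diff A B" "d = 0 \<or> sym_diff A {i} \<notin> M"
  proof (cases "d = 0")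
    case True
    have "sym_diff A B \<noteq> {}"
      using Suc.hyps(2) by (metis card.empty nat.distinct(1))
    then show ?thesis using True that by blast
  next
    case False
    then have "2 \<le> card (sym_diff A B)"
      using Suc.hyps(2) by simp
    then obtain S where "S \<subseteq> sym_diff A B" "card S = 2"
      by (meson obtain_subset_with_card_n)
    then obtain i j where ij: "i \<in> sym_diff A B" "j \<in> sym_diff A B" "i \<noteq> j"
      by (auto simp: card_2_iff)
    then have "sym_diff (sym_diff A {i}) (sym_diff A {j}) = {i, j}"
      by blast
    then have "card (sym_diff (sym_diff A {i}) (sym_diff A {j})) = 2"
      using ij by simp
    then show ?thesis using M ij that by blast
  qed
  then obtain C where C: "C \<subseteq> {1..n}" "card (sym_diff A C) = 1" "d = card (sym_diff C B)"
    "d = 0 \<or> C \<notin> M"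
    using step[OF i(1)] by metis
  obtain p where p: "vwalk p (hypercube n)" "hd p = C" "last p = B"
    "vwalk_length p = d" "set p \<inter> (M - {C, B}) = {}"
    using Suc.hyps(1)[OF C(3,1)] C(3) by metis
  have "p \<noteq> []" using p(1) by auto
  \<comment> \<open>The induction hypothesis exempts \<open>C\<close> as an endpoint of
    \<open>p\<close>, but \<open>C\<close> need not be an endpoint of \<open>A # p\<close>. So
    \<open>C\<close> has to avoid \<open>M\<close> or equal \<open>B\<close>.\<close>
  have "hd p = last p" if "d = 0"
    using p(4) \<open>p \<noteq> []\<close> that by (cases p) auto
  then have "C \<notin> M \<or> C = B"
    using C(4) p(2,3) by blast
  then have "set (A # p) \<inter> (M - {A, B}) = {}"
    using p(5) unfolding list.set(2) by blast
  moreover have "vwalk (A # p) (hypercube n)"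
    using vwalk_hypercube_Cons[OF p(1) Suc.prems] C(2) p(2) by simp
  moreover have "vwalk_length (A # p) = Suc d"
    using p(4) \<open>p \<noteq> []\<close> by (cases p) auto
  moreover have "hd (A # p) = A" "last (A # p) = B"
    using p(3) \<open>p \<noteq> []\<close> by simp_all
  ultimately show ?case
    using Suc.hyps(2) by metis
qed

section \<open>Shortest paths and visibility\<close>

lemma length_vwalk_to_vpath_le: "length (vwalk_to_vpath p) \<le> length p"
  by (induction p rule: vwalk_to_vpath.induct)
    (auto intro: le_SucI order_trans[OF _ length_dropWhile_le])

lemma distinct_vwalk_to_vpath: "distinct (vwalk_to_vpath p)"
  by (induction p rule: vwalk_to_vpath.induct) (auto dest: vwalk_to_vpath_subset)

text \<open>The shortcut is distinct and uses only vertices of \<open>p\<close>, so \<open>p\<close>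
  has as many different vertices as entries. This serves to show that a walk of minimal length is a
  path.\<close>

lemma length_vwalk_to_vpath_eq_imp_distinct:
  assumes "length (vwalk_to_vpath p) = length p"
  shows "distinct p"
proof -
  have "length p = card (set (vwalk_to_vpath p))"
    using assms by (simp add: distinct_card distinct_vwalk_to_vpath)
  also have "\<dots> \<le> card (set p)"
    by (intro card_mono) (auto dest: vwalk_to_vpath_subset)
  finally show ?thesis
    using card_length[of p] by (intro card_distinct) simp
qed

text \<open>This removes distinctness and minimality from later arguments: Hamming distance bounds
  the length of every walk from below and is attained, and shortcutting a walk of that length cannot
  shorten it.\<close>

lemma is_shortest_path_hypercube_iff:
  assumes "A \<subseteq> {1..n}" "B \<subseteq> {1..n}"
  shows "is_shortest_path (hypercube n) A p B \<longleftrightarrow>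
    vwalk p (hypercube n) \<and> hd p = A \<and> last p = B \<and> vwalk_length p = card (sym_diff A B)"
    (is "?L \<longleftrightarrow> ?R")
proof
  assume ?L
  then have p: "vpath p (hypercube n)" "hd p = A" "last p = B"
    and min: "\<And>q. vpath q (hypercube n) \<Longrightarrow> hd q = A \<Longrightarrow> last q = B \<Longrightarrow>
      vwalk_length p \<le> vwalk_length q"
    unfolding is_shortest_path_def by blast+
  obtain q where q: "vwalk q (hypercube n)" "hd q = A" "last q = B"
    "vwalk_length q = card (sym_diff A B)"
    using hypercube_visible_path[OF assms, of "{}"] by auto
  have "vwalk_length p \<le> vwalk_length (vwalk_to_vpath q)"
    using q by (intro min) (auto simp: vwalk_to_vpath_vpath vwalk_to_vpath_hd vwalk_to_vpath_last)
  also have "\<dots> \<le> vwalk_length q"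
    using length_vwalk_to_vpath_le[of q] by simp
  finally show ?R
    using p q hypercube_vwalk_length_ge[of p n] by (auto simp: vpath_def)
next
  assume ?R
  then have p: "vwalk p (hypercube n)" "hd p = A" "last p = B" "p \<noteq> []"
    and len: "vwalk_length p = card (sym_diff A B)"
    by (auto simp: vwalk_def)
  have "vwalk (vwalk_to_vpath p) (hypercube n)"
    using vwalk_to_vpath_vpath[OF p(1)] by (simp add: vpath_def)
  then have "vwalk_length p \<le> vwalk_length (vwalk_to_vpath p)"
    using hypercube_vwalk_length_ge[of "vwalk_to_vpath p" n] p len
    by (simp add: vwalk_to_vpath_hd vwalk_to_vpath_last)
  \<comment> \<open>Nonemptiness matters because \<open>vwalk_length\<close> is
    \<open>length\<close> minus one in truncated subtraction.\<close>
  moreover have "length p > 0" "length (vwalk_to_vpath p) > 0"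
    using p(4) by (simp_all add: vwalk_to_vpath_nonempty)
  ultimately have "length (vwalk_to_vpath p) = length p"
    using length_vwalk_to_vpath_le[of p] unfolding vwalk_length_simp by linarith
  then have "vpath p (hypercube n)"
    by (rule vpathI[OF p(1) length_vwalk_to_vpath_eq_imp_distinct])
  moreover have "vwalk_length p \<le> vwalk_length q"
    if "vpath q (hypercube n)" "hd q = A" "last q = B" for q
    using that hypercube_vwalk_length_ge[of q n] len unfolding vpath_def by metis
  ultimately show ?L
    using p unfolding is_shortest_path_def by blast
qed

lemma total_mutual_visibility_set_hypercube_iff:
  "total_mutual_visibility_set (hypercube n) M \<longleftrightarrow>
    M \<subseteq> Pow {1..n} \<and> (\<forall>A\<in>M. \<forall>B\<in>M. card (sym_diff A B) \<noteq> 2)"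
    (is "?L \<longleftrightarrow> ?R")
proof
  assume R: ?R
  have "visible (hypercube n) M A B" if AB: "A \<subseteq> {1..n}" "B \<subseteq> {1..n}" for A B
    using hypercube_visible_path[OF AB, of M] R
    unfolding visible_def is_shortest_path_hypercube_iff[OF AB] by metis
  with R show ?L
    unfolding total_mutual_visibility_set_def by (simp add: hypercube_def)
next
  assume ?L
  then have M: "M \<subseteq> Pow {1..n}"
    and vis: "\<And>A B. A \<subseteq> {1..n} \<Longrightarrow> B \<subseteq> {1..n} \<Longrightarrow> visible (hypercube n) M A B"
    by (simp_all add: total_mutual_visibility_set_def hypercube_def)
  have "card (sym_diff A B) \<noteq> 2" if AB: "A \<in> M" "B \<in> M" for A B
  proof
    assume "card (sym_diff A B) = 2"
    then obtain i j where ij: "sym_diff A B = {i, j}" "i \<noteq> j"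
      by (meson card_2_iff)
    \<comment> \<open>\<open>U\<close> and \<open>V\<close> are the other two corners of the 4-cycle
      through \<open>A\<close> and \<open>B\<close>. Every shortest path between them has
      \<open>A\<close> or \<open>B\<close> as its middle vertex.\<close>
    obtain U V where U: "U = sym_diff A {i}" and V: "V = sym_diff A {j}"
      by blast
    have UV: "sym_diff U V = {i, j}"
      unfolding U V using ij(2) by blast
    have "{i, j} \<subseteq> {1..n}"
      using ij(1) AB M by blast
    then have sub: "U \<subseteq> {1..n}" "V \<subseteq> {1..n}"
      unfolding U V using AB M by blast+
    have "card (sym_diff U V) = 2"
      unfolding UV using ij(2) by simp
    then obtain p where p: "vwalk p (hypercube n)" "hd p = U" "last p = V" "vwalk_length p = 2"
      "set p \<inter> (M - {U, V}) = {}"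
      using vis[OF sub] unfolding visible_def is_shortest_path_hypercube_iff[OF sub] by metis
    have "length p = Suc (Suc (Suc 0))"
      using p(4) by simp
    then obtain X where pX: "p = [U, X, V]"
      using p(2,3) by (auto simp: length_Suc_conv)
    have "(U, X) \<in> parcs (hypercube n)" "(X, V) \<in> parcs (hypercube n)"
      using p(1) unfolding pX by (simp_all add: vwalk_def)
    then have "card (sym_diff U X) = 1" "card (sym_diff X V) = 1"
      by (simp_all add: hypercube_def)
    then obtain a b where ab: "sym_diff U X = {a}" "sym_diff X V = {b}"
      by (meson card_1_singletonE)
    have "sym_diff U V \<subseteq> sym_diff U X \<union> sym_diff X V"
      by blast
    then have "{i, j} \<subseteq> {a, b}"
      unfolding UV ab by blast
    then have "a = i \<or> a = j"
      using ij(2) by auto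
    have "X = sym_diff U (sym_diff U X)"
      by blast
    then have X: "X = sym_diff U {a}"
      unfolding ab(1) .
    \<comment> \<open>From \<open>U\<close>, flipping \<open>i\<close> returns to \<open>A\<close>,
      while flipping \<open>j\<close> leads to \<open>B\<close>.\<close>
    have B: "sym_diff A (sym_diff A B) = B"
      by blast
    have "sym_diff (sym_diff A {i}) {i} = A" "sym_diff (sym_diff A {i}) {j} = sym_diff A {i, j}"
      using ij(2) by blast+
    then have "X = A \<or> X = B"
      using X B \<open>a = i \<or> a = j\<close> unfolding U ij(1) by metis
    \<comment> \<open>It remains to see that \<open>A\<close> and \<open>B\<close> differ from the
      endpoints \<open>U\<close> and \<open>V\<close>, so that the middle vertex \<open>X\<close> is
      not exempt and really blocks the path.\<close>
    have "B = sym_diff A {i, j}"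
      using B unfolding ij(1) by (rule sym)
    moreover have "sym_diff (sym_diff A {i, j}) {i} = sym_diff A {j}"
      "sym_diff (sym_diff A {i, j}) {j} = sym_diff A {i}"
      using ij(2) by blast+
    ultimately have "U = sym_diff B {j}" "V = sym_diff B {i}"
      unfolding U V by metis+
    moreover have "S \<noteq> sym_diff S {x}" for S :: "nat set" and x
      by blast
    ultimately have "X \<notin> {U, V}"
      using \<open>X = A \<or> X = B\<close> U V by (metis insertE singletonD)
    moreover have "X \<in> M"
      using \<open>X = A \<or> X = B\<close> AB by metis
    moreover have "X \<in> set p"
      unfolding pX by simp
    ultimately show False
      using p(5) by blast
  qed
  with M show ?R by blast
qed

section \<open>The Hamming syndrome\<close>

lemma even_card_sym_diff:
  assumes "finite A" "finite B"
  shows "even (card (sym_diff A B)) \<longleftrightarrow> (even (card A) \<longleftrightarrow> even (card B))"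
proof -
  have "card (sym_diff A B) = card (A - B) + card (B - A)"
    using assms by (intro card_Un_disjoint) auto
  moreover have "card A = card (A - B) + card (A \<inter> B)" "card B = card (B - A) + card (A \<inter> B)"
    using card_Int_Diff[OF assms(1), of B] card_Int_Diff[OF assms(2), of A]
    by (simp_all add: Int_commute)
  ultimately show ?thesis by auto
qed

text \<open>Each coordinate is labelled by its own binary expansion. The set consists of the
  positions of the ones in the bitwise exclusive or of the labels of \<open>A\<close>, cut off after
  \<open>k\<close> bits.\<close>

definition syndrome :: "nat \<Rightarrow> nat set \<Rightarrow> nat set" where
  "syndrome k A = {j. j < k \<and> odd (card {i \<in> A. bit i j})}"

text \<open>Flipping two coordinates \<open>a\<close> and \<open>b\<close> changes the syndrome in
  each position where their labels differ, and distinct labels below \<open>2 ^ k\<close> differ in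
  some position below \<open>k\<close>.\<close>

lemma syndrome_eq_imp_card_sym_diff_neq_2:
  assumes "A \<subseteq> {..<2 ^ k}" "B \<subseteq> {..<2 ^ k}" "syndrome k A = syndrome k B"
  shows "card (sym_diff A B) \<noteq> 2"
proof
  assume "card (sym_diff A B) = 2"
  then obtain a b where ab: "sym_diff A B = {a, b}" "a \<noteq> b"
    by (auto simp: card_2_iff)
  then have less: "a < 2 ^ k" "b < 2 ^ k"
    using assms by blast+
  obtain j where j: "bit a j \<noteq> bit b j"
    using ab(2) bit_eqI by blast
  have "take_bit k a = a" "take_bit k b = b"
    using less by (auto simp: take_bit_nat_eq_self_iff)
  then have "j < k"
    using j by (metis bit_take_bit_iff)
  have fin: "finite A" "finite B"
    using assms finite_subset by blast+
  let ?X = "{i \<in> A. bit i j}" and ?Y = "{i \<in> B. bit i j}"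
  \<comment> \<open>Exactly one of \<open>a\<close> and \<open>b\<close> has bit \<open>j\<close>,
    so the parity in position \<open>j\<close> changes.\<close>
  have "sym_diff ?X ?Y = {i \<in> {a, b}. bit i j}"
    using ab(1) by blast
  also have "\<dots> = {if bit a j then a else b}"
    using j by auto
  finally have "odd (card (sym_diff ?X ?Y))" by simp
  moreover have "odd (card ?X) \<longleftrightarrow> odd (card ?Y)"
    using assms(3) \<open>j < k\<close> by (auto simp: syndrome_def)
  ultimately show False
    using even_card_sym_diff[of ?X ?Y] fin by simp
qed

section \<open>Bounds on the total mutual-visibility number\<close>

lemma finite_total_mutual_visibility_sets_hypercube:
  "finite {M. total_mutual_visibility_set (hypercube n) M}"
  by (rule finite_subset[of _ "Pow (Pow {1..n})"])
    (auto simp: total_mutual_visibility_set_hypercube_iff)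

lemma card_le_total_mutual_visibility_number_hypercube:
  assumes "total_mutual_visibility_set (hypercube n) M"
  shows "card M \<le> \<mu>\<^sub>t (hypercube n)"
  using assms finite_total_mutual_visibility_sets_hypercube
  by (auto simp: total_mutual_visibility_number_def)

lemma card_total_mutual_visibility_set_hypercube_le:
  assumes "total_mutual_visibility_set (hypercube n) M"
  shows "card M * n \<le> 2 ^ n"
proof -
  have M: "M \<subseteq> Pow {1..n}" "\<And>A B. A \<in> M \<Longrightarrow> B \<in> M \<Longrightarrow> card (sym_diff A B) \<noteq> 2"
    using assms by (auto simp: total_mutual_visibility_set_hypercube_iff)
  have "inj_on (\<lambda>(A, i). sym_diff A {i}) (M \<times> {1..n})"
  proof (rule inj_onI, clarify)
    fix A B i j assume "A \<in> M" "B \<in> M" and eq: "sym_diff A {i} = sym_diff B {j}"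
    \<comment> \<open>Members with a common neighbour differ by \<open>sym_diff {i} {j}\<close>,
      which has the forbidden size 2 unless \<open>i = j\<close>.\<close>
    have "sym_diff A B = sym_diff {i} {j}"
      using eq by blast
    moreover have "sym_diff {i} {j} = {i, j}" if "i \<noteq> j"
      using that by blast
    ultimately have "i = j"
      using M(2)[OF \<open>A \<in> M\<close> \<open>B \<in> M\<close>] by (cases "i = j") auto
    then show "A = B \<and> i = j"
      using eq by blast
  qed
  moreover have "(\<lambda>(A, i). sym_diff A {i}) ` (M \<times> {1..n}) \<subseteq> Pow {1..n}"
    using M(1) by auto
  ultimately have "card (M \<times> {1..n}) \<le> card (Pow {1..n})"
    by (rule card_inj_on_le) simp
  then show ?thesis
    by (simp add: card_Pow card_cartesian_product)
qed

lemma total_mutual_visibility_number_hypercube_le: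
  "\<mu>\<^sub>t (hypercube n) * n \<le> 2 ^ n"
proof -
  \<comment> \<open>The empty set makes the family nonempty, so that \<open>Max\<close> is
    attained.\<close>
  have "total_mutual_visibility_set (hypercube n) {}"
    by (simp add: total_mutual_visibility_set_hypercube_iff)
  then have "\<mu>\<^sub>t (hypercube n) \<in> card ` {M. total_mutual_visibility_set (hypercube n) M}"
    unfolding total_mutual_visibility_number_def
    using finite_total_mutual_visibility_sets_hypercube by (intro Max_in) auto
  then show ?thesis
    using card_total_mutual_visibility_set_hypercube_le by auto
qed

lemma total_mutual_visibility_number_hypercube_ge:
  assumes "n < 2 ^ k"
  shows "2 ^ n \<le> 2 ^ k * \<mu>\<^sub>t (hypercube n)"
proof -
  define C where "C S = {A \<in> Pow {1..n}. syndrome k A = S}" for S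
  have "{1..n} \<subseteq> {..<2 ^ k}"
    using assms by auto
  then have "card (sym_diff A B) \<noteq> 2" if "A \<in> C S" "B \<in> C S" for A B S
    using that by (intro syndrome_eq_imp_card_sym_diff_neq_2[of _ k]) (auto simp: C_def)
  then have C: "total_mutual_visibility_set (hypercube n) (C S)" for S
    by (auto simp: total_mutual_visibility_set_hypercube_iff C_def)
  \<comment> \<open>The \<open>2 ^ k\<close> possible syndromes index a cover of the cube by
    admissible sets, and pigeonhole does the rest.\<close>
  have "Pow {1..n} = (\<Union>S\<in>Pow {..<k}. C S)"
    by (auto simp: C_def syndrome_def)
  then have "2 ^ n = card (\<Union>S\<in>Pow {..<k}. C S)"
    by (metis card_Pow card_atLeastAtMost diff_Suc_1 finite_atLeastAtMost)
  also have "\<dots> \<le> (\<Sum>S\<in>Pow {..<k}. card (C S))"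
    by (rule card_UN_le) simp
  also have "\<dots> \<le> (\<Sum>S\<in>Pow {..<k}. \<mu>\<^sub>t (hypercube n))"
    by (intro sum_mono card_le_total_mutual_visibility_number_hypercube C)
  finally show ?thesis by (simp add: card_Pow)
qed

theorem theorem1p7:
  fixes n :: nat
  assumes "n \<ge> 1"
  shows "2 ^ (n - 1) / real n \<le> real (\<mu>\<^sub>t (hypercube n)) \<and>
         real (\<mu>\<^sub>t (hypercube n)) \<le> 2 ^ n / real n \<and>
         ((\<exists>m::nat. m \<ge> 1 \<and> n = 2 ^ m - 1) \<longrightarrow>
            2 ^ n / real (n + 1) \<le> real (\<mu>\<^sub>t (hypercube n)) \<and>
            real (\<mu>\<^sub>t (hypercube n)) \<le> 2 ^ n / real n)"
proof -
  let ?\<mu> = "\<mu>\<^sub>t (hypercube n)"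
  have "real (?\<mu> * n) \<le> real (2 ^ n)"
    using total_mutual_visibility_number_hypercube_le[of n] by (simp only: of_nat_le_iff)
  then have upper: "real ?\<mu> \<le> 2 ^ n / real n"
    using assms by (simp add: field_simps)
  \<comment> \<open>The word length is \<open>k + 1\<close> here, so the number of classes
    \<open>2 ^ (k + 1)\<close> is at most \<open>2 * n\<close>.\<close>
  obtain k where k: "2 ^ k \<le> n" "n < 2 ^ (k + 1)"
    using ex_power_ivl1[of 2 n] assms by auto
  have "2 * 2 ^ (n - 1) = (2::nat) ^ n"
    using assms by (cases n) auto
  also have "\<dots> \<le> 2 * (2 ^ k * ?\<mu>)"
    using total_mutual_visibility_number_hypercube_ge[OF k(2)] by (simp add: mult.assoc)
  also have "\<dots> \<le> 2 * (n * ?\<mu>)"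
    using k(1) by simp
  finally have "real (2 ^ (n - 1)) \<le> real (n * ?\<mu>)"
    by (simp only: of_nat_le_iff)
  then have lower: "2 ^ (n - 1) / real n \<le> real ?\<mu>"
    using assms by (simp add: field_simps)
  have perfect: "2 ^ n / real (n + 1) \<le> real ?\<mu>" if n: "n = 2 ^ m - 1" for m
  proof -
    \<comment> \<open>Words of length \<open>m\<close> suffice, and the number of classes is exactly
      \<open>n + 1\<close>.\<close>
    have "n + 1 = 2 ^ m"
      using n by simp
    then have "2 ^ n \<le> (n + 1) * ?\<mu>"
      using total_mutual_visibility_number_hypercube_ge[of n m] by simp
    then have "real (2 ^ n) \<le> real ((n + 1) * ?\<mu>)"
      by (simp only: of_nat_le_iff)
    then show ?thesis
      by (simp add: field_simps)
  qed
  show ?thesis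
    using upper lower perfect by blast
qed

end
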